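(* Let $S\subseteq\mathbb N^2$ be a (local) good semigroup, let $\boldsymbol e=(e_1,e_2)$ be its minimal nonzero element, and let $\mathrm{Ap}(S)=\bigcup_{i=1}^N A_i$ be the partition of its Apéry set into levels. Then $N=e_1+e_2$.
   Context: $\mathbb N$ is the set of nonnegative integers. On $\mathbb Z^2$, $\alpha=(\alpha_1,\alpha_2)\le\beta=(\beta_1,\beta_2)$ means $\alpha_1\le\beta_1$ and $\alpha_2\le\beta_2$; $\alpha\wedge\beta=(\min(\alpha_1,\beta_1),\min(\alpha_2,\beta_2))$; $\alpha\ll\beta$ means $\alpha_1<\beta_1$ and $\alpha_2<\beta_2$; $\alpha\le\le\beta$ means $\alpha=\beta$ or $\alpha\ll\beta$. A good semigroup is a submonoid $S$ of $(\mathbb N^2,+)$ such that: (G1) $\alpha,\beta\in S\Rightarrow\alpha\wedge\beta\in S$; (G2) if $\alpha,\beta\in S$ and $\alpha_i=\beta_i$ for some $i\in\{1,2\}$, where $j$ is the other index, then there is $\delta\in S$ with $\delta_i>\alpha_i=\beta_i$, $\delta_j\ge\min\{\alpha_j,\beta_j\}$, and $\delta_j=\min\{\alpha_j,\beta_j\}$ if $\alpha_j\neq\beta_j$ (for $\alpha\ne\beta$ as in the standard convention); (G3) there is $c\in S$ with $c+\mathbb N^2\subseteq S$. All good semigroups are assumed local: $(0,0)$ is the only element of $S$ with a zero component. Then $S\setminus\{(0,0)\}$ has a minimum with respect to $\le$, denoted $\boldsymbol e=(e_1,e_2)$. The Apéry set is $\mathrm{Ap}(S)=\{\alpha\in S:\alpha-\boldsymbol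 e\notin S\}=S\setminus(\boldsymbol e+S)$. Levels of the Apéry set: for $i\ge1$, having defined $D^{(1)},\dots,D^{(i-1)}$, let $B^{(i)}$ be the set of elements of $\mathrm{Ap}(S)\setminus\bigcup_{j<i}D^{(j)}$ that are maximal in it with respect to $\le\le$, let $C^{(i)}=\{\alpha\in B^{(i)}:\alpha=\beta_1\wedge\beta_2\text{ for some }\beta_1,\beta_2\in B^{(i)}\setminus\{\alpha\}\}$, and $D^{(i)}=B^{(i)}\setminus C^{(i)}$. For some positive integer $N$ (taken least), $\mathrm{Ap}(S)=\bigcup_{i=1}^N D^{(i)}$, and the $D^{(i)}$ are pairwise disjoint. The levels are $A_i=D^{(N+1-i)}$, $1\le i\le N$. *)

theory Defs
  imports "HOL-Library.Product_Order" "HOL-Library.Product_Plus" "HOL-Library.Disjoint_Sets"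
begin

text \<open>
  Points of \<open>\<nat>\<^sup>2\<close> have type \<^typ>\<open>nat \<times> nat\<close>, with the componentwise zero, addition, order and
  meet (\<open>inf\<close>) of the library.
\<close>

definition pt_ll :: "nat \<times> nat \<Rightarrow> nat \<times> nat \<Rightarrow> bool"  (infix "\<lless>" 50)
  where "\<alpha> \<lless> \<beta> \<longleftrightarrow> fst \<alpha> < fst \<beta> \<and> snd \<alpha> < snd \<beta>"

definition pt_lele :: "nat \<times> nat \<Rightarrow> nat \<times> nat \<Rightarrow> bool"  (infix "\<le>\<le>" 50)
  where "\<alpha> \<le>\<le> \<beta> \<longleftrightarrow> \<alpha> = \<beta> \<or> \<alpha> \<lless> \<beta>"

definition submonoid :: "(nat \<times> nat) set \<Rightarrow> bool"
  where "submonoid S \<longleftrightarrow> 0 \<in> S \<and> (\<forall>\<alpha>\<in>S. \<forall>\<beta>\<in>S. \<alpha> + \<beta> \<in> S)"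

text \<open>The two conjuncts before the last one are (G2) for the index 1 and for the index 2.\<close>

definition good_semigroup :: "(nat \<times> nat) set \<Rightarrow> bool"
  where "good_semigroup S \<longleftrightarrow>
    submonoid S \<and>
    (\<forall>\<alpha>\<in>S. \<forall>\<beta>\<in>S. inf \<alpha> \<beta> \<in> S) \<and>
    (\<forall>\<alpha>\<in>S. \<forall>\<beta>\<in>S. \<alpha> \<noteq> \<beta> \<and> fst \<alpha> = fst \<beta> \<longrightarrow>
      (\<exists>\<delta>\<in>S. fst \<delta> > fst \<alpha> \<and> snd \<delta> \<ge> min (snd \<alpha>) (snd \<beta>) \<and>
        (snd \<alpha> \<noteq> snd \<beta> \<longrightarrow> snd \<delta> = min (snd \<alpha>) (snd \<beta>)))) \<and>
    (\<forall>\<alpha>\<in>S. \<forall>\<beta>\<in>S. \<alpha> \<noteq> \<beta> \<and> snd \<alpha> = snd \<beta> \<longrightarrow>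
      (\<exists>\<delta>\<in>S. snd \<delta> > snd \<alpha> \<and> fst \<delta> \<ge> min (fst \<alpha>) (fst \<beta>) \<and>
        (fst \<alpha> \<noteq> fst \<beta> \<longrightarrow> fst \<delta> = min (fst \<alpha>) (fst \<beta>)))) \<and>
    (\<exists>c\<in>S. \<forall>\<delta>. c + \<delta> \<in> S)"

definition local_semigroup :: "(nat \<times> nat) set \<Rightarrow> bool"
  where "local_semigroup S \<longleftrightarrow> (\<forall>\<alpha>\<in>S. fst \<alpha> = 0 \<or> snd \<alpha> = 0 \<longrightarrow> \<alpha> = 0)"

text \<open>\<open>Least\<close> is the minimum for the componentwise order; it exists for local good semigroups,
  see \<open>min_elt_least\<close> below.\<close>

definition min_elt :: "(nat \<times> nat) set \<Rightarrow> nat \<times> nat"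
  where "min_elt S = (LEAST \<alpha>. \<alpha> \<in> S - {0})"

text \<open>The form \<open>S \<setminus> (e + S)\<close> avoids truncated subtraction.\<close>

definition apery :: "(nat \<times> nat) set \<Rightarrow> (nat \<times> nat) set"
  where "apery S = S - (\<lambda>\<sigma>. min_elt S + \<sigma>) ` S"

definition lele_maximal :: "(nat \<times> nat) set \<Rightarrow> (nat \<times> nat) set"
  where "lele_maximal X = {\<alpha> \<in> X. \<forall>\<beta>\<in>X. \<alpha> \<le>\<le> \<beta> \<longrightarrow> \<beta> = \<alpha>}"

definition meets :: "(nat \<times> nat) set \<Rightarrow> (nat \<times> nat) set"
  where "meets B = {\<alpha> \<in> B. \<exists>\<beta>\<^sub>1 \<in> B - {\<alpha>}. \<exists>\<beta>\<^sub>2 \<in> B - {\<alpha>}. \<alpha> = inf \<beta>\<^sub>1 \<beta>\<^sub>2}"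

text \<open>\<open>D_level S i\<close> is the set \<open>D\<^sup>(\<^sup>i\<^sup>)\<close>, for \<open>i \<ge> 1\<close>; the value at \<open>i = 0\<close> is never used.\<close>

function D_level :: "(nat \<times> nat) set \<Rightarrow> nat \<Rightarrow> (nat \<times> nat) set"
  where "D_level S i =
    (let B = lele_maximal (apery S - (\<Union>j\<in>{1..<i}. D_level S j)) in B - meets B)"
  by auto
termination
  by (relation "measure snd") auto

declare D_level.simps [simp del]

text \<open>The number \<open>N\<close> of levels; it exists for local good semigroups, see
  \<open>num_levels_partition\<close> below.\<close>

definition num_levels :: "(nat \<times> nat) set \<Rightarrow> nat"
  where "num_levels S = (LEAST N. 0 < N \<and> apery S = (\<Union>i\<in>{1..N}. D_level S i))"

definition apery_level :: "(nat \<times> nat) set \<Rightarrow> nat \<Rightarrow> (nat \<times> nat) set"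
  where "apery_level S i = D_level S (num_levels S + 1 - i)"


subsection \<open>The minimum and the number of levels are well defined\<close>

lemma min_elt_least:
  assumes "good_semigroup S" "local_semigroup S"
  shows "min_elt S \<in> S - {0}" and "\<And>\<alpha>. \<alpha> \<in> S - {0} \<Longrightarrow> min_elt S \<le> \<alpha>"
proof -
  obtain c where c: "c \<in> S" "\<And>\<delta>. c + \<delta> \<in> S"
    using assms(1) unfolding good_semigroup_def by blast
  have inf_cl: "\<And>\<alpha> \<beta>. \<alpha> \<in> S \<Longrightarrow> \<beta> \<in> S \<Longrightarrow> inf \<alpha> \<beta> \<in> S"
    using assms(1) unfolding good_semigroup_def by blast
  have pos: "\<And>\<alpha>. \<alpha> \<in> S - {0} \<Longrightarrow> 0 < fst \<alpha> \<and> 0 < snd \<alpha>"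
    using assms(2) unfolding local_semigroup_def by auto
  have "c + (1, 1) \<in> S - {0}"
    using c(2) by (auto simp: prod_eq_iff)
  then obtain \<mu> where mu: "\<mu> \<in> S - {0}"
    and mumin: "\<And>\<alpha>. \<alpha> \<in> S - {0} \<Longrightarrow> fst \<mu> + snd \<mu> \<le> fst \<alpha> + snd \<alpha>"
    using ex_has_least_nat[of "\<lambda>\<alpha>. \<alpha> \<in> S - {0}" _ "\<lambda>\<alpha>. fst \<alpha> + snd \<alpha>"] by blast
  have low: "\<mu> \<le> \<alpha>" if "\<alpha> \<in> S - {0}" for \<alpha>
  proof -
    have "inf \<mu> \<alpha> \<in> S"
      using inf_cl mu that by blast
    moreover have "0 < fst (inf \<mu> \<alpha>)"
      using pos[OF mu] pos[OF that] by (simp add: inf_min)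
    hence "inf \<mu> \<alpha> \<noteq> 0"
      by (auto simp: prod_eq_iff)
    ultimately have "fst \<mu> + snd \<mu> \<le> fst (inf \<mu> \<alpha>) + snd (inf \<mu> \<alpha>)"
      using mumin by blast
    thus ?thesis
      by (auto simp: less_eq_prod_def inf_min min_def split: if_splits)
  qed
  have "min_elt S = \<mu>"
    unfolding min_elt_def by (rule Least_equality) (use mu low in auto)
  thus "min_elt S \<in> S - {0}" "\<And>\<alpha>. \<alpha> \<in> S - {0} \<Longrightarrow> min_elt S \<le> \<alpha>"
    using mu low by auto
qed

definition apery_rest :: "(nat \<times> nat) set \<Rightarrow> nat \<Rightarrow> (nat \<times> nat) set"
  where "apery_rest S k = apery S - (\<Union>j\<in>{1..<k}. D_level S j)"

lemma D_level_rest: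
  "D_level S k = lele_maximal (apery_rest S k) - meets (lele_maximal (apery_rest S k))"
  unfolding apery_rest_def by (subst D_level.simps) (simp add: Let_def)

lemma apery_rest_Suc: "1 \<le> k \<Longrightarrow> apery_rest S (Suc k) = apery_rest S k - D_level S k"
  unfolding apery_rest_def by (auto simp: less_Suc_eq)

lemma lele_maximalI:
  "\<alpha> \<in> X \<Longrightarrow> (\<And>\<beta>. \<beta> \<in> X \<Longrightarrow> \<not> \<alpha> \<lless> \<beta>) \<Longrightarrow> \<alpha> \<in> lele_maximal X"
  unfolding lele_maximal_def pt_lele_def by blast

lemma lele_maximalD:
  "\<alpha> \<in> lele_maximal X \<Longrightarrow> \<alpha> \<in> X" "\<alpha> \<in> lele_maximal X \<Longrightarrow> \<beta> \<in> X \<Longrightarrow> \<not> \<alpha> \<lless> \<beta>"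
  unfolding lele_maximal_def pt_lele_def pt_ll_def by auto

lemma maximal_removed:
  assumes k: "1 \<le> k" and a: "\<alpha> \<in> lele_maximal (apery_rest S k)"
  shows "\<alpha> \<notin> apery_rest S (Suc (Suc k))"
proof
  assume "\<alpha> \<in> apery_rest S (Suc (Suc k))"
  hence a1: "\<alpha> \<in> apery_rest S (Suc k)" and nD: "\<alpha> \<notin> D_level S (Suc k)"
    using apery_rest_Suc[of "Suc k" S] by auto
  have sub: "apery_rest S (Suc k) \<subseteq> apery_rest S k"
    using apery_rest_Suc[OF k] by auto
  have "\<alpha> \<in> lele_maximal (apery_rest S (Suc k))"
    using a1 a sub by (blast intro: lele_maximalI dest: lele_maximalD)
  with nD have "\<alpha> \<in> meets (lele_maximal (apery_rest S (Suc k)))"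
    by (simp add: D_level_rest)
  then obtain \<beta>1 \<beta>2 where b: "\<beta>1 \<in> lele_maximal (apery_rest S (Suc k))" "\<beta>1 \<noteq> \<alpha>"
      "\<alpha> = inf \<beta>1 \<beta>2"
    unfolding meets_def by blast
  have b1: "\<beta>1 \<in> apery_rest S k" "\<beta>1 \<notin> D_level S k"
    using lele_maximalD(1)[OF b(1)] apery_rest_Suc[OF k] by auto
  have le: "\<alpha> \<le> \<beta>1"
    using b(3) by simp
  have "\<beta>1 \<in> lele_maximal (apery_rest S k)"
  proof (rule lele_maximalI[OF b1(1)])
    fix \<gamma> assume "\<gamma> \<in> apery_rest S k"
    with lele_maximalD(2)[OF a] le show "\<not> \<beta>1 \<lless> \<gamma>"
      by (fastforce simp: pt_ll_def less_eq_prod_def)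
  qed
  with b1 have "\<beta>1 \<in> meets (lele_maximal (apery_rest S k))"
    by (simp add: D_level_rest)
  then obtain \<gamma>1 \<gamma>2 where g: "\<gamma>1 \<in> apery_rest S k" "\<gamma>2 \<in> apery_rest S k"
      "\<gamma>1 \<noteq> \<beta>1" "\<gamma>2 \<noteq> \<beta>1" "\<beta>1 = inf \<gamma>1 \<gamma>2"
    unfolding meets_def by (blast dest: lele_maximalD)
  have "\<not> \<alpha> \<lless> \<gamma>1" "\<not> \<alpha> \<lless> \<gamma>2"
    using lele_maximalD(2)[OF a] g by blast+
  moreover have "fst \<beta>1 = min (fst \<gamma>1) (fst \<gamma>2)" "snd \<beta>1 = min (snd \<gamma>1) (snd \<gamma>2)"
    using g(5) by (simp_all add: inf_min)
  moreover have "fst \<alpha> \<le> fst \<beta>1" "snd \<alpha> \<le> snd \<beta>1"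
    using le by (simp_all add: less_eq_prod_def)
  moreover have "fst \<gamma>1 \<noteq> fst \<beta>1 \<or> snd \<gamma>1 \<noteq> snd \<beta>1" "fst \<gamma>2 \<noteq> fst \<beta>1 \<or> snd \<gamma>2 \<noteq> snd \<beta>1"
      "fst \<beta>1 \<noteq> fst \<alpha> \<or> snd \<beta>1 \<noteq> snd \<alpha>"
    using g(3,4) b(2) by (simp_all add: prod_eq_iff)
  ultimately show False
    unfolding pt_ll_def by linarith
qed

lemma apery_rest_height:
  "\<alpha> \<in> apery_rest S (2 * m + 1) \<Longrightarrow> \<exists>\<gamma>\<in>apery S. fst \<alpha> + m \<le> fst \<gamma> \<and> snd \<alpha> + m \<le> snd \<gamma>"
proof (induction m arbitrary: \<alpha>)
  case 0
  thus ?case by (auto simp: apery_rest_def)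
next
  case (Suc m)
  have "\<alpha> \<in> apery_rest S (2 * m + 1)"
    using Suc.prems by (auto simp: apery_rest_def)
  moreover have "\<alpha> \<notin> lele_maximal (apery_rest S (2 * m + 1))"
    using maximal_removed[of "2 * m + 1" \<alpha> S] Suc.prems by auto
  ultimately obtain \<beta> where b: "\<beta> \<in> apery_rest S (2 * m + 1)" "\<alpha> \<lless> \<beta>"
    by (blast intro: lele_maximalI)
  obtain \<gamma> where "\<gamma> \<in> apery S" "fst \<beta> + m \<le> fst \<gamma>" "snd \<beta> + m \<le> snd \<gamma>"
    using Suc.IH[OF b(1)] by blast
  with b(2) show ?case
    by (intro bexI[of _ \<gamma>]) (auto simp: pt_ll_def)
qed

lemma num_levels_exists:
  assumes "good_semigroup S"
  shows "\<exists>N. 0 < N \<and> apery S = (\<Union>i\<in>{1..N}. D_level S i)"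
proof -
  obtain c where c: "\<And>\<delta>. c + \<delta> \<in> S"
    using assms unfolding good_semigroup_def by blast
  define e where "e = min_elt S"
  define m where "m = fst c + fst e + snd c + snd e + 1"
  have "apery_rest S (2 * m + 1) = {}"
  proof (rule ccontr)
    assume "apery_rest S (2 * m + 1) \<noteq> {}"
    then obtain \<gamma> where g: "\<gamma> \<in> apery S" "m \<le> fst \<gamma>" "m \<le> snd \<gamma>"
      using apery_rest_height[of _ S m] by fastforce
    have "\<gamma> = e + (c + (fst \<gamma> - fst e - fst c, snd \<gamma> - snd e - snd c))"
      using g(2,3) by (auto simp: prod_eq_iff m_def)
    with c have "\<gamma> \<in> (\<lambda>\<sigma>. e + \<sigma>) ` S"
      by blast
    with g(1) show False
      by (simp add: apery_def e_def)
  qed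
  moreover have "D_level S i \<subseteq> apery S" for i
    by (subst D_level_rest) (auto simp: lele_maximal_def apery_rest_def)
  ultimately have "apery S = (\<Union>i\<in>{1..2 * m}. D_level S i)"
    by (auto simp: apery_rest_def atLeastLessThanSuc_atLeastAtMost)
  moreover have "0 < 2 * m"
    by (simp add: m_def)
  ultimately show ?thesis
    by blast
qed

lemma num_levels_partition:
  assumes "good_semigroup S"
  shows "0 < num_levels S" and "apery S = (\<Union>i\<in>{1..num_levels S}. apery_level S i)"
    and "disjoint_family_on (apery_level S) {1..num_levels S}"
proof -
  let ?N = "num_levels S"
  have N: "0 < ?N \<and> apery S = (\<Union>i\<in>{1..?N}. D_level S i)"
    unfolding num_levels_def by (rule LeastI_ex[OF num_levels_exists[OF assms]])
  thus "0 < ?N" ..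
  have "(\<lambda>i. ?N + 1 - i) ` {1..?N} = {1..?N}"
  proof
    show "{1..?N} \<subseteq> (\<lambda>i. ?N + 1 - i) ` {1..?N}"
    proof
      fix i assume "i \<in> {1..?N}"
      hence "i = ?N + 1 - (?N + 1 - i)" "?N + 1 - i \<in> {1..?N}"
        by auto
      thus "i \<in> (\<lambda>i. ?N + 1 - i) ` {1..?N}"
        by blast
    qed
  qed auto
  hence "(\<Union>i\<in>{1..?N}. apery_level S i) = (\<Union>i\<in>{1..?N}. D_level S i)"
    unfolding apery_level_def by (metis image_image)
  with N show "apery S = (\<Union>i\<in>{1..?N}. apery_level S i)"
    by simp
  have *: "D_level S i \<inter> D_level S j = {}" if "1 \<le> i" "i < j" for i j
    using that by (auto simp: D_level_rest[of S j] lele_maximal_def apery_rest_def)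
  have "apery_level S i \<inter> apery_level S j = {}"
    if "i \<in> {1..?N}" "j \<in> {1..?N}" "i \<noteq> j" for i j
  proof (cases "i < j")
    case True
    have "1 \<le> ?N + 1 - j" "?N + 1 - j < ?N + 1 - i"
      using that True by auto
    from *[OF this] show ?thesis
      unfolding apery_level_def by blast
  next
    case False
    have "1 \<le> ?N + 1 - i" "?N + 1 - i < ?N + 1 - j"
      using that False by auto
    from *[OF this] show ?thesis
      unfolding apery_level_def by blast
  qed
  thus "disjoint_family_on (apery_level S) {1..?N}"
    by (auto simp: disjoint_family_on_def)
qed

end

theory Submission
  imports Defs
begin

text \<open>
  For \<open>T = S\<close> and for \<open>T = e + S\<close>, (G2) makes the number of jumps of \<open>T\<close> along a lattice path from
  the origin to \<open>\<alpha>\<close> independent of the path; it plays the role of the length of \<open>R / R(\<alpha>)\<close> for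
  the ring \<open>R\<close> of a curve with two branches. Let \<open>h \<alpha>\<close> be the difference of these numbers for \<open>S\<close>
  and \<open>e + S\<close>. Then \<open>h\<close> is nondecreasing, it is \<open>0\<close> at the origin and \<open>e\<^sub>1 + e\<^sub>2\<close> far away, and
  by (G1) it increases from each \<open>\<alpha>\<close> of the Apery set in at least one of the two directions.
  Conversely every value of \<open>h\<close> below \<open>e\<^sub>1 + e\<^sub>2\<close> taken at some point is taken at an element
  of the Apery set above that point. These facts show that \<open>D\<^sup>(\<^sup>i\<^sup>)\<close> is exactly the set of the elements
  of the Apery set with \<open>h = e\<^sub>1 + e\<^sub>2 - i\<close>.
\<close>

section \<open>Counting jumps along lattice paths\<close>

definition col :: "(nat \<times> nat) set \<Rightarrow> nat \<Rightarrow> nat \<Rightarrow> bool"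
  where "col T a b \<longleftrightarrow> (\<exists>y\<ge>b. (a, y) \<in> T)"

definition row :: "(nat \<times> nat) set \<Rightarrow> nat \<Rightarrow> nat \<Rightarrow> bool"
  where "row T a b \<longleftrightarrow> (\<exists>x\<ge>a. (x, b) \<in> T)"

text \<open>The path runs along the axis to \<open>(a, 0)\<close> and then up. A unit step is a jump
  if it loses an element of \<open>T\<close> among those componentwise above the current point;
  \<open>col\<close> and \<open>row\<close> test this for steps to the right and up.\<close>

definition jumps :: "(nat \<times> nat) set \<Rightarrow> nat \<Rightarrow> nat \<Rightarrow> int"
  where "jumps T a b = (\<Sum>i<a. of_bool (col T i 0)) + (\<Sum>j<b. of_bool (row T a j))"

text \<open>The path independence of \<^const>\<open>jumps\<close> around a unit square.\<close>

definition exchange :: "(nat \<times> nat) set \<Rightarrow> bool"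
  where "exchange T \<longleftrightarrow> (\<forall>a b. (a, b) \<in> T \<longrightarrow> row T (Suc a) b = col T a (Suc b))"

lemma col_unfold: "col T a b \<longleftrightarrow> (a, b) \<in> T \<or> col T a (Suc b)"
  unfolding col_def using Suc_le_eq le_eq_less_or_eq by metis

lemma row_unfold: "row T a b \<longleftrightarrow> (a, b) \<in> T \<or> row T (Suc a) b"
  unfolding row_def using Suc_le_eq le_eq_less_or_eq by metis

lemma jumps_0_0 [simp]: "jumps T 0 0 = 0"
  by (simp add: jumps_def)

lemma jumps_Suc_snd: "jumps T a (Suc b) = jumps T a b + of_bool (row T a b)"
  by (simp add: jumps_def)

text \<open>The horizontal step is counted at height 0 and lifted one unit square at a time. If the
  lower left corner is in \<open>T\<close>, both steps leaving it are jumps and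
  \<open>exchange\<close> equates the other two; if not, opposite sides agree.\<close>

lemma jumps_Suc_fst:
  assumes "exchange T"
  shows "jumps T (Suc a) b = jumps T a b + of_bool (col T a b)"
proof (induction b)
  case 0
  show ?case by (simp add: jumps_def)
next
  case (Suc b)
  show ?case
  proof (cases "(a, b) \<in> T")
    case True
    with assms have "row T (Suc a) b = col T a (Suc b)"
      by (simp add: exchange_def)
    with True Suc show ?thesis
      using col_unfold[of T a b] row_unfold[of T a b] by (simp add: jumps_Suc_snd)
  next
    case False
    with Suc show ?thesis
      using col_unfold[of T a b] row_unfold[of T a b] by (simp add: jumps_Suc_snd)
  qed
qed

section \<open>Translates and full quadrants\<close>

lemma translate_mem_iff:
  fixes e :: "nat \<times> nat"
  shows "(a + fst e, b + snd e) \<in> (+) e ` T \<longleftrightarrow> (a, b) \<in> T"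
proof -
  have "(a + fst e, b + snd e) = e + (a, b)"
    by (simp add: prod_eq_iff add.commute)
  thus ?thesis
    by auto
qed

lemma col_translate: "col ((+) e ` T) (a + fst e) (b + snd e) = col T a b"
proof
  assume "col ((+) e ` T) (a + fst e) (b + snd e)"
  then obtain y \<sigma> where "b + snd e \<le> y" "\<sigma> \<in> T" "(a + fst e, y) = e + \<sigma>"
    by (auto simp: col_def)
  thus "col T a b"
    unfolding col_def by (intro exI[of _ "snd \<sigma>"]) (cases \<sigma>; auto simp: prod_eq_iff)
next
  assume "col T a b"
  then obtain y where "b \<le> y" "(a, y) \<in> T"
    by (auto simp: col_def)
  thus "col ((+) e ` T) (a + fst e) (b + snd e)"
    unfolding col_def by (intro exI[of _ "y + snd e"]) (simp add: translate_mem_iff)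
qed

lemma row_translate: "row ((+) e ` T) (a + fst e) (b + snd e) = row T a b"
proof
  assume "row ((+) e ` T) (a + fst e) (b + snd e)"
  then obtain x \<sigma> where "a + fst e \<le> x" "\<sigma> \<in> T" "(x, b + snd e) = e + \<sigma>"
    by (auto simp: row_def)
  thus "row T a b"
    unfolding row_def by (intro exI[of _ "fst \<sigma>"]) (cases \<sigma>; auto simp: prod_eq_iff)
next
  assume "row T a b"
  then obtain x where "a \<le> x" "(x, b) \<in> T"
    by (auto simp: row_def)
  thus "row ((+) e ` T) (a + fst e) (b + snd e)"
    unfolding row_def by (intro exI[of _ "x + fst e"]) (simp add: translate_mem_iff)
qed

lemma exchange_translate:
  assumes "exchange T"
  shows "exchange ((+) e ` T)"
  unfolding exchange_def
proof (intro allI impI)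
  fix a b assume "(a, b) \<in> (+) e ` T"
  then obtain a' b' where *: "(a', b') \<in> T" "a = a' + fst e" "b = b' + snd e"
    by (auto simp: prod_eq_iff)
  show "row ((+) e ` T) (Suc a) b = col ((+) e ` T) a (Suc b)"
    using assms * row_translate[of e T "Suc a'" b'] col_translate[of e T a' "Suc b'"]
    by (simp add: exchange_def)
qed

text \<open>All elements of the translate are above \<open>e\<close>, so the path to
  \<open>e\<close> has no jumps; the later steps correspond to those of \<open>T\<close>.\<close>

lemma jumps_translate:
  assumes "exchange T"
  shows "jumps ((+) e ` T) (a + fst e) (b + snd e) = jumps T a b"
proof (induction b)
  case 0
  show ?case
  proof (induction a)
    case 0
    have "\<not> col ((+) e ` T) i 0" if "i < fst e" for i
      using that by (auto simp: col_def prod_eq_iff)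
    moreover have "\<not> row ((+) e ` T) a j" if "j < snd e" for a j
      using that by (auto simp: row_def prod_eq_iff)
    ultimately show ?case
      by (simp add: jumps_def)
  next
    case (Suc a)
    thus ?case
      using col_translate[of e T a 0]
      by (simp add: jumps_Suc_fst assms exchange_translate)
  qed
next
  case (Suc b)
  thus ?case
    by (simp add: jumps_Suc_snd row_translate)
qed

lemma jumps_full:
  assumes "exchange T" and full: "\<And>x y. a \<le> x \<Longrightarrow> b \<le> y \<Longrightarrow> (x, y) \<in> T"
  shows "jumps T (a + m) (b + n) = jumps T a b + int m + int n"
proof (induction n)
  case 0
  show ?case
  proof (induction m)
    case (Suc m)
    have "col T (a + m) b"
      using full by (auto simp: col_def)
    with Suc show ?case
      by (simp add: jumps_Suc_fst assms(1))
  qed simp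
next
  case (Suc n)
  have "row T (a + m) (b + n)"
    using full by (auto simp: row_def)
  with Suc show ?case
    by (simp add: jumps_Suc_snd)
qed

section \<open>The function \<open>h\<close> and its growth\<close>

locale local_good_semigroup =
  fixes S :: "(nat \<times> nat) set"
  assumes good: "good_semigroup S" and loc: "local_semigroup S"
begin

definition e :: "nat \<times> nat" where "e = min_elt S"

abbreviation eS :: "(nat \<times> nat) set" where "eS \<equiv> (+) e ` S"

definition n :: int where "n = int (fst e + snd e)"

definition h :: "nat \<Rightarrow> nat \<Rightarrow> int" where "h a b = jumps S a b - jumps eS a b"

lemma e_in: "e \<in> S" and e_nonzero: "e \<noteq> 0"
  using min_elt_least(1)[OF good loc] by (auto simp: e_def)

lemma n_pos: "0 < n"
  using e_nonzero by (auto simp: n_def prod_eq_iff)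

lemma apery_eq: "apery S = S - eS"
  by (simp add: apery_def e_def)

lemma eS_subset: "eS \<subseteq> S"
  using good e_in by (auto simp: good_semigroup_def submonoid_def)

text \<open>In (G2) the two elements differ in the other coordinate, so that coordinate of
  \<open>\<delta>\<close> is exactly the smaller one, that of \<open>(a, b)\<close>.\<close>

lemma exchange_S: "exchange S"
  unfolding exchange_def
proof (intro allI impI iffI)
  fix a b assume ab: "(a, b) \<in> S"
  {
    assume "row S (Suc a) b"
    then obtain x where "Suc a \<le> x" "(x, b) \<in> S"
      by (auto simp: row_def)
    moreover have "\<forall>\<alpha>\<in>S. \<forall>\<beta>\<in>S. \<alpha> \<noteq> \<beta> \<and> snd \<alpha> = snd \<beta> \<longrightarrow>
      (\<exists>\<delta>\<in>S. snd \<delta> > snd \<alpha> \<and> fst \<delta> \<ge> min (fst \<alpha>) (fst \<beta>) \<and>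
        (fst \<alpha> \<noteq> fst \<beta> \<longrightarrow> fst \<delta> = min (fst \<alpha>) (fst \<beta>)))"
      using good by (simp add: good_semigroup_def)
    ultimately obtain \<delta> where "\<delta> \<in> S" "snd \<delta> > b" "fst \<delta> = a"
      using ab by fastforce
    thus "col S a (Suc b)"
      by (cases \<delta>) (auto simp: col_def Suc_le_eq)
  }
  {
    assume "col S a (Suc b)"
    then obtain y where "Suc b \<le> y" "(a, y) \<in> S"
      by (auto simp: col_def)
    moreover have "\<forall>\<alpha>\<in>S. \<forall>\<beta>\<in>S. \<alpha> \<noteq> \<beta> \<and> fst \<alpha> = fst \<beta> \<longrightarrow>
      (\<exists>\<delta>\<in>S. fst \<delta> > fst \<alpha> \<and> snd \<delta> \<ge> min (snd \<alpha>) (snd \<beta>) \<and>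
        (snd \<alpha> \<noteq> snd \<beta> \<longrightarrow> snd \<delta> = min (snd \<alpha>) (snd \<beta>)))"
      using good by (simp add: good_semigroup_def)
    ultimately obtain \<delta> where "\<delta> \<in> S" "fst \<delta> > a" "snd \<delta> = b"
      using ab by fastforce
    thus "row S (Suc a) b"
      by (cases \<delta>) (auto simp: row_def Suc_le_eq)
  }
qed

lemma S_meet:
  assumes "col S a b" "row S a b"
  shows "(a, b) \<in> S"
proof -
  obtain x y where *: "b \<le> y" "(a, y) \<in> S" "a \<le> x" "(x, b) \<in> S"
    using assms by (auto simp: col_def row_def)
  hence "inf (a, y) (x, b) \<in> S"
    using good by (auto simp: good_semigroup_def simp del: inf_Pair_Pair)
  thus ?thesis
    using * by (simp add: inf_min)
qed

lemma eS_meet: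
  assumes "col eS a b" "row eS a b"
  shows "(a, b) \<in> eS"
proof -
  have "fst e \<le> a" "snd e \<le> b"
    using assms by (auto simp: col_def row_def prod_eq_iff)
  then obtain a' b' where ab: "a = a' + fst e" "b = b' + snd e"
    by (metis le_iff_add add.commute)
  hence "(a', b') \<in> S"
    using assms S_meet by (simp add: col_translate row_translate)
  thus ?thesis
    using ab by (simp add: translate_mem_iff)
qed

lemma h_0_0 [simp]: "h 0 0 = 0"
  by (simp add: h_def)

text \<open>As \<open>eS\<close> is contained in \<open>S\<close>, every jump of \<open>eS\<close>
  is one of \<open>S\<close>, so the increment is 0 or 1.\<close>

lemma h_Suc_fst: "h (Suc a) b = h a b + of_bool (col S a b \<and> \<not> col eS a b)"
proof -
  have "col eS a b \<Longrightarrow> col S a b"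
    using eS_subset by (auto simp: col_def)
  thus ?thesis
    by (auto simp: h_def jumps_Suc_fst exchange_S exchange_translate)
qed

lemma h_Suc_snd: "h a (Suc b) = h a b + of_bool (row S a b \<and> \<not> row eS a b)"
proof -
  have "row eS a b \<Longrightarrow> row S a b"
    using eS_subset by (auto simp: row_def)
  thus ?thesis
    by (auto simp: h_def jumps_Suc_snd)
qed

lemma h_Suc_fst_le: "h (Suc a) b \<le> h a b + 1"
  by (simp add: h_Suc_fst)

lemma h_Suc_snd_le: "h a (Suc b) \<le> h a b + 1"
  by (simp add: h_Suc_snd)

lemma h_mono:
  assumes "a \<le> a'" "b \<le> b'"
  shows "h a b \<le> h a' b'"
proof -
  have "h a b \<le> h a' b"
    by (rule lift_Suc_mono_le[OF _ assms(1)]) (simp add: h_Suc_fst)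
  also have "\<dots> \<le> h a' b'"
    by (rule lift_Suc_mono_le[OF _ assms(2)]) (simp add: h_Suc_snd)
  finally show ?thesis .
qed

lemma h_nonneg: "0 \<le> h a b"
  using h_mono[of 0 a 0 b] by simp

lemma conductor_bound:
  obtains M where "a \<le> M" "b \<le> M" "h M M = n" "\<And>x y. M \<le> x \<Longrightarrow> M \<le> y \<Longrightarrow> (x, y) \<in> eS"
proof -
  obtain c where c: "\<And>\<delta>. c + \<delta> \<in> S"
    using good unfolding good_semigroup_def by blast
  define M where "M = a + b + fst c + snd c + fst e + snd e"
  have full: "(x, y) \<in> S" if "fst c \<le> x" "snd c \<le> y" for x y
    using c[of "(x - fst c, y - snd c)"] that by (cases c) simp
  \<comment> \<open>\<open>(p, q)\<close> is \<open>(M, M)\<close> minus \<open>e\<close>. It is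
    already beyond the conductor, so each of the \<open>e\<close>-many remaining steps to
    \<open>(M, M)\<close> is a jump of \<open>S\<close>, while \<open>eS\<close> has at
    \<open>(M, M)\<close> the count of \<open>S\<close> at \<open>(p, q)\<close>.\<close>
  define p where "p = M - fst e"
  define q where "q = M - snd e"
  have pq: "M = p + fst e" "M = q + snd e" "fst c \<le> p" "snd c \<le> q"
    by (auto simp: p_def q_def M_def)
  have "jumps S (p + fst e) (q + snd e) = jumps S p q + int (fst e) + int (snd e)"
    by (rule jumps_full[OF exchange_S]) (use full pq in auto)
  moreover have "jumps eS (p + fst e) (q + snd e) = jumps S p q"
    by (rule jumps_translate[OF exchange_S])
  ultimately have "h (p + fst e) (q + snd e) = n"
    by (simp add: h_def n_def)
  hence "h M M = n"
    by (metis pq(1,2))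
  moreover have "(x, y) \<in> eS" if "M \<le> x" "M \<le> y" for x y
  proof -
    have "(x - fst e, y - snd e) \<in> S"
      using full that by (auto simp: M_def)
    moreover have "(x, y) = e + (x - fst e, y - snd e)"
      using that by (auto simp: M_def prod_eq_iff)
    ultimately show ?thesis
      by blast
  qed
  ultimately show ?thesis
    using that[of M] by (auto simp: M_def)
qed

lemma h_le: "h a b \<le> n"
proof -
  obtain M where "a \<le> M" "b \<le> M" "h M M = n"
    using conductor_bound[of a b] by metis
  thus ?thesis
    using h_mono[of a M b M] by simp
qed

text \<open>Both steps are jumps of \<open>S\<close>. Were both also jumps of \<open>eS\<close>,
  then \<open>eS_meet\<close> would put \<open>(a, b)\<close> in \<open>eS\<close>.\<close>

lemma h_step_apery:
  assumes "(a, b) \<in> apery S"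
  shows "h (Suc a) b = h a b + 1 \<or> h a (Suc b) = h a b + 1"
proof -
  have "(a, b) \<in> S" "\<not> (col eS a b \<and> row eS a b)"
    using assms eS_meet by (auto simp: apery_eq)
  moreover from this have "col S a b" "row S a b"
    by (auto simp: col_def row_def)
  ultimately show ?thesis
    by (auto simp: h_Suc_fst h_Suc_snd)
qed

lemma h_less_apery: "(a, b) \<in> apery S \<Longrightarrow> h a b < n"
  using h_step_apery[of a b] h_le[of "Suc a" b] h_le[of a "Suc b"] by auto

lemma h_less_diagonal:
  assumes "(a, b) \<in> apery S" "a < a'" "b < b'"
  shows "h a b < h a' b'"
proof -
  have "h (Suc a) b \<le> h a' b'" "h a (Suc b) \<le> h a' b'"
    using assms by (simp_all add: h_mono)
  with h_step_apery[OF assms(1)] show ?thesis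
    by linarith
qed

section \<open>Apery elements with a prescribed value of \<open>h\<close>\<close>

lemma apery_above:
  assumes less: "h a b < n"
  obtains x y where "a \<le> x" "b \<le> y" "(x, y) \<in> apery S" "h x y = h a b"
proof -
  obtain M where M: "a \<le> M" "b \<le> M" "h M M = n" "\<And>x y. M \<le> x \<Longrightarrow> M \<le> y \<Longrightarrow> (x, y) \<in> eS"
    using conductor_bound[of a b] by metis
  \<comment> \<open>For \<open>M \<le> x\<close> the column of \<open>x\<close> contains elements of
    \<open>eS\<close> arbitrarily high, so a step to the right is a jump of both sets.\<close>
  have const1: "h x y = h M y" if "M \<le> x" for x y
    using that
  proof (induction x rule: dec_induct)
    case (step x)
    have "col eS x y"
      unfolding col_def using M(4) step.hyps by (intro exI[of _ "max M y"]) auto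
    with step show ?case by (simp add: h_Suc_fst)
  qed simp
  have const2: "h x y = h x M" if "M \<le> y" for x y
    using that
  proof (induction y rule: dec_induct)
    case (step y)
    have "row eS x y"
      unfolding row_def using M(4) step.hyps by (intro exI[of _ "max M x"]) auto
    with step show ?case by (simp add: h_Suc_snd)
  qed simp
  \<comment> \<open>A point of this box with the same value and maximal coordinate sum makes
    \<open>h\<close> grow at every step that stays in the box.\<close>
  define P where "P = (\<lambda>(x, y). a \<le> x \<and> x \<le> M \<and> b \<le> y \<and> y \<le> M \<and> h x y = h a b)"
  have "P (a, b)"
    using M by (simp add: P_def)
  moreover have "\<forall>z. P z \<longrightarrow> fst z + snd z < 2 * M + 1"
    by (auto simp: P_def)
  ultimately obtain z where z: "P z" "\<forall>w. P w \<longrightarrow> fst w + snd w \<le> fst z + snd z"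
    using ex_has_greatest_nat[of P "(a, b)" "\<lambda>z. fst z + snd z"] by blast
  obtain x y where xy: "z = (x, y)" by (cases z)
  from z(1) have *: "a \<le> x" "x \<le> M" "b \<le> y" "y \<le> M" "h x y = h a b"
    by (auto simp: P_def xy)
  have right: "col S x y \<and> \<not> col eS x y" if "x < M"
  proof (rule ccontr)
    assume "\<not> ?thesis"
    hence "P (Suc x, y)"
      using * that by (simp add: P_def h_Suc_fst)
    with z(2) show False
      by (fastforce simp: xy)
  qed
  have up: "row S x y \<and> \<not> row eS x y" if "y < M"
  proof (rule ccontr)
    assume "\<not> ?thesis"
    hence "P (x, Suc y)"
      using * that by (simp add: P_def h_Suc_snd)
    with z(2) show False
      by (fastforce simp: xy)
  qed
  \<comment> \<open>The corner \<open>(M, M)\<close> is excluded, since \<open>h\<close> equals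
    \<open>n\<close> there.\<close>
  consider "x < M" "y < M" | "x = M" "y < M" | "x < M" "y = M"
    using * less M(3) by fastforce
  thus ?thesis
  proof cases
    case 1
    hence "(x, y) \<in> S" "(x, y) \<notin> eS"
      using right up S_meet by (auto simp: col_def)
    with * show ?thesis
      using that[of x y] by (simp add: apery_eq)
  next
    \<comment> \<open>On the right edge only the row gives an element of \<open>S\<close>; it may
      lie beyond the box, where \<open>const1\<close> preserves the value.\<close>
    case 2
    then obtain x' where x': "M \<le> x'" "(x', y) \<in> S" "(x', y) \<notin> eS"
      using up by (auto simp: row_def)
    with 2 * const1[of x' y] M show ?thesis
      using that[of x' y] by (simp add: apery_eq)
  next
    case 3
    then obtain y' where y': "M \<le> y'" "(x, y') \<in> S" "(x, y') \<notin> eS"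
      using right by (auto simp: col_def)
    with 3 * const2[of y' x] M show ?thesis
      using that[of x y'] by (simp add: apery_eq)
  qed
qed

section \<open>Levels as level sets of \<open>h\<close>\<close>

definition apery_upto :: "int \<Rightarrow> (nat \<times> nat) set"
  where "apery_upto m = {\<alpha> \<in> apery S. h (fst \<alpha>) (snd \<alpha>) \<le> m}"

lemma maximal_top:
  assumes "(a, b) \<in> apery S" "h a b = m"
  shows "(a, b) \<in> lele_maximal (apery_upto m)"
proof (rule lele_maximalI)
  show "(a, b) \<in> apery_upto m"
    using assms by (simp add: apery_upto_def)
next
  fix \<beta> assume "\<beta> \<in> apery_upto m"
  thus "\<not> (a, b) \<lless> \<beta>"
    using h_less_diagonal[of a b "fst \<beta>" "snd \<beta>"] assms by (auto simp: apery_upto_def pt_ll_def)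
qed

lemma top_not_meet:
  assumes "(a, b) \<in> apery S" "h a b = m"
  shows "(a, b) \<notin> meets (lele_maximal (apery_upto m))"
proof
  assume "(a, b) \<in> meets (lele_maximal (apery_upto m))"
  then obtain \<beta>1 \<beta>2 where "\<beta>1 \<in> lele_maximal (apery_upto m)" "\<beta>2 \<in> lele_maximal (apery_upto m)"
      and ne: "\<beta>1 \<noteq> (a, b)" "\<beta>2 \<noteq> (a, b)" "(a, b) = inf \<beta>1 \<beta>2"
    unfolding meets_def by blast
  hence sub: "\<beta>1 \<in> apery_upto m" "\<beta>2 \<in> apery_upto m"
    by (auto dest: lele_maximalD(1))
  obtain x y x' y' where \<beta>: "\<beta>1 = (x, y)" "\<beta>2 = (x', y')"
    by (cases \<beta>1, cases \<beta>2)
  have le: "h x y \<le> m" "h x' y' \<le> m" and "a = min x x'" "b = min y y'"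
      "x \<noteq> a \<or> y \<noteq> b" "x' \<noteq> a \<or> y' \<noteq> b"
    using sub ne by (auto simp: \<beta> apery_upto_def inf_min)
  \<comment> \<open>Two elements with meet \<open>(a, b)\<close>, both different from it, lie on the
    two arms of the corner at \<open>(a, b)\<close>. But \<open>h\<close> already exceeds
    \<open>m\<close> after the first step along one arm.\<close>
  hence "(a < x \<and> y = b \<and> x' = a \<and> b < y') \<or> (a < x' \<and> y' = b \<and> x = a \<and> b < y)"
    by linarith
  hence "(\<exists>x>a. h x b \<le> m) \<and> (\<exists>y>b. h a y \<le> m)"
    using le by blast
  then obtain x y where "a < x" "h x b \<le> m" "b < y" "h a y \<le> m"
    by blast
  thus False
    using h_step_apery[OF assms(1)] h_mono[of "Suc a" x b b] h_mono[of a a "Suc b" y] assms(2)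
    by auto
qed

text \<open>If \<open>h\<close> is at most \<open>m\<close> at the diagonal neighbour,
  \<open>apery_above\<close> refutes maximality. Otherwise \<open>(a, b)\<close> is a meet of two
  elements of value \<open>m\<close>.\<close>

lemma below_top:
  assumes ap: "(a, b) \<in> apery S" and less: "h a b < m" and m: "m < n"
  shows "(a, b) \<notin> lele_maximal (apery_upto m) - meets (lele_maximal (apery_upto m))"
proof (cases "h (Suc a) (Suc b) \<le> m")
  case True
  then obtain x y where "Suc a \<le> x" "Suc b \<le> y" "(x, y) \<in> apery S" "h x y = h (Suc a) (Suc b)"
    using apery_above[of "Suc a" "Suc b"] m by (metis le_less_trans)
  hence "(x, y) \<in> apery_upto m" "(a, b) \<lless> (x, y)"
    using True by (auto simp: apery_upto_def pt_ll_def)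
  thus ?thesis
    by (auto dest: lele_maximalD(2))
next
  case False
  \<comment> \<open>Two unit steps lead from a value below \<open>m\<close> to one above it, so each
    raises \<open>h\<close> by exactly 1.\<close>
  from False less have steps: "h (Suc a) b = m" "h a (Suc b) = m"
    using h_Suc_fst_le[of a b] h_Suc_snd_le[of a b] h_Suc_fst_le[of a "Suc b"]
      h_Suc_snd_le[of "Suc a" b] by linarith+
  obtain x y where xy: "Suc a \<le> x" "b \<le> y" "(x, y) \<in> apery S" "h x y = m"
    using apery_above[of "Suc a" b] steps m by metis
  obtain x' y' where xy': "a \<le> x'" "Suc b \<le> y'" "(x', y') \<in> apery S" "h x' y' = m"
    using apery_above[of a "Suc b"] steps m by metis
  \<comment> \<open>Leaving the row or the column would put the point above the diagonal neighbour,
    where \<open>h\<close> exceeds \<open>m\<close>.\<close>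
  have "y = b" "x' = a"
    using False h_mono[of "Suc a" x "Suc b" y] h_mono[of "Suc a" x' "Suc b" y'] xy xy'
    by fastforce+
  hence "(a, b) = inf (x, y) (x', y')" "(x, y) \<noteq> (a, b)" "(x', y') \<noteq> (a, b)"
    using xy xy' by (auto simp: inf_min)
  moreover have "(x, y) \<in> lele_maximal (apery_upto m)" "(x', y') \<in> lele_maximal (apery_upto m)"
    using xy xy' by (auto intro: maximal_top)
  ultimately show ?thesis
    unfolding meets_def by blast
qed

lemma maximal_nonmeets_apery_upto:
  assumes "m < n"
  shows "lele_maximal (apery_upto m) - meets (lele_maximal (apery_upto m)) =
    {\<alpha> \<in> apery S. h (fst \<alpha>) (snd \<alpha>) = m}" (is "?L = ?R")
proof (rule set_eqI)
  fix \<alpha> :: "nat \<times> nat"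
  obtain a b where \<alpha>: "\<alpha> = (a, b)" by (cases \<alpha>)
  have "(a, b) \<in> apery S \<and> h a b = m" if "(a, b) \<in> ?L"
  proof -
    have "(a, b) \<in> apery_upto m"
      using that lele_maximalD(1) by blast
    hence "(a, b) \<in> apery S" "h a b \<le> m"
      by (simp_all add: apery_upto_def)
    moreover from this have "\<not> h a b < m"
      using below_top[OF _ _ assms] that by blast
    ultimately show ?thesis
      by simp
  qed
  moreover have "(a, b) \<in> ?L" if "(a, b) \<in> apery S" "h a b = m"
    using maximal_top[OF that] top_not_meet[OF that] by (rule DiffI)
  ultimately have "(a, b) \<in> ?L \<longleftrightarrow> (a, b) \<in> apery S \<and> h a b = m"
    by blast
  thus "\<alpha> \<in> ?L \<longleftrightarrow> \<alpha> \<in> ?R"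
    by (simp add: \<alpha>)
qed

text \<open>On the Apery set \<open>h\<close> is at most \<open>n - 1\<close>, and each level
  removes exactly the top remaining value.\<close>

lemma apery_rest_eq: "apery_rest S (Suc k) = apery_upto (n - 1 - int k)"
proof (induction k)
  case 0
  show ?case
    using h_less_apery by (fastforce simp: apery_rest_def apery_upto_def)
next
  case (Suc k)
  have "D_level S (Suc k) = {\<alpha> \<in> apery S. h (fst \<alpha>) (snd \<alpha>) = n - 1 - int k}"
    by (simp add: D_level_rest Suc maximal_nonmeets_apery_upto)
  thus ?case
    using apery_rest_Suc[of "Suc k" S] Suc by (auto simp: apery_upto_def)
qed

lemma D_level_eq:
  assumes "1 \<le> i"
  shows "D_level S i = {\<alpha> \<in> apery S. h (fst \<alpha>) (snd \<alpha>) = n - int i}"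
proof -
  obtain k where "i = Suc k"
    using assms by (cases i) auto
  thus ?thesis
    by (simp add: D_level_rest apery_rest_eq maximal_nonmeets_apery_upto algebra_simps)
qed

lemma num_levels_eq: "num_levels S = nat n"
  unfolding num_levels_def
proof (rule Least_equality)
  have "\<alpha> \<in> (\<Union>i\<in>{1..nat n}. D_level S i)" if "\<alpha> \<in> apery S" for \<alpha>
  proof -
    let ?i = "nat (n - h (fst \<alpha>) (snd \<alpha>))"
    have "0 \<le> h (fst \<alpha>) (snd \<alpha>)" "h (fst \<alpha>) (snd \<alpha>) < n"
      using h_nonneg h_less_apery[of "fst \<alpha>" "snd \<alpha>"] that by auto
    hence "?i \<in> {1..nat n}" "\<alpha> \<in> D_level S ?i"
      using that by (auto simp: D_level_eq)
    thus ?thesis by blast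
  qed
  thus "0 < nat n \<and> apery S = (\<Union>i\<in>{1..nat n}. D_level S i)"
    using n_pos by (auto simp: D_level_eq)
next
  fix N assume N: "0 < N \<and> apery S = (\<Union>i\<in>{1..N}. D_level S i)"
  \<comment> \<open>The origin has value 0, so the only level containing it has index
    \<open>n\<close>; no smaller union covers the Apery set.\<close>
  have "0 \<in> apery S"
    using good e_nonzero by (auto simp: apery_eq good_semigroup_def submonoid_def prod_eq_iff)
  with N obtain i where "i \<in> {1..N}" "0 \<in> D_level S i"
    by blast
  thus "nat n \<le> N"
    by (auto simp: D_level_eq)
qed

end

theorem theorem3p4:
  fixes S :: "(nat \<times> nat) set"
  assumes "good_semigroup S" and "local_semigroup S"
  shows "num_levels S = fst (min_elt S) + snd (min_elt S)"
proof -
  interpret local_good_semigroup S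
    by unfold_locales (fact assms)+
  show ?thesis
    using num_levels_eq by (simp add: n_def e_def)
qed

end
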